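(* Let $\mathcal{M}=(W,R,V)$ and $\mathcal{M}'=(W',R',V')$ be Kripke models and let $\mathcal{Z}=(\mathcal{Z}_1,\mathcal{Z}_2,\ldots)$ be a graded tuple bisimulation between $\mathcal{M}$ and $\mathcal{M}'$. Define $Z\subseteq W\times W'$ by: $wZw'$ iff $\{w\}\mathcal{Z}_1\{w'\}$. Then $Z$ is a graded bisimulation between $\mathcal{M}$ and $\mathcal{M}'$.
   Context: $\mathbb{N}$ includes $0$. A Kripke model is $(W,R,V)$ with $W$ a set, $R\subseteq W\times W$ and $V:\mathsf{Prop}\to\mathcal{P}(W)$, where $\mathsf{Prop}$ is a set of proposition letters; $w$ satisfies $p$ iff $w\in V(p)$. Write $R[w]=\{v:wRv\}$. For a set $X$, $\mathcal{P}_{\ge n}(X)=\{X'\subseteq X:|X'|\ge n\}$ and $\mathcal{P}_{<\omega}(X)$ is the set of finite subsets of $X$. For $\Gamma\subseteq\mathcal{P}(W)$, $\uparrow\Gamma=\{Y\in\mathcal{P}(W):\exists X\in\Gamma,\ X\subseteq Y\}$ (likewise over $W'$). Graded bisimulation: a non-empty relation $Z\subseteq W\times W'$ is a graded bisimulation between $\mathcal{M}=(W,R,V)$ and $\mathcal{M}'=(W',R',V')$ if, for all $w\in W$, $w'\in W'$ and $n\in\mathbb{N}$: (Prop) if $wZw'$, then $w$ and $w'$ satisfy the same proposition letters; (Forth) if $wZw'$ and $X\in\uparrow\mathcal{P}_{\ge n}(R[w])$, then there is $X'\subseteq W'$ with $X'\in\uparrow\mathcal{P}_{\ge n}(R'[w'])$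 and $\forall x'\in X'\,\exists x\in X:\ xZx'$; (Back) if $wZw'$ and $X'\in\uparrow\mathcal{P}_{\ge n}(R'[w'])$, then there is $X\subseteq W$ with $X\in\uparrow\mathcal{P}_{\ge n}(R[w])$ and $\forall x\in X\,\exists x'\in X':\ xZx'$. Graded tuple bisimulation: a tuple $\mathcal{Z}=(\mathcal{Z}_1,\mathcal{Z}_2,\ldots)$ of relations (indexed by $i\ge1$) is a graded tuple bisimulation between $\mathcal{M}$ and $\mathcal{M}'$ iff: (1) $\mathcal{Z}_1$ is non-empty; (2) for all $i$, $\mathcal{Z}_i\subseteq\mathcal{P}_{<\omega}(W)\times\mathcal{P}_{<\omega}(W')$; (3) if $X\mathcal{Z}_iX'$, then $|X|=|X'|=i$; (4) if $\{w\}\mathcal{Z}_1\{w'\}$, then $w$ and $w'$ satisfy the same proposition letters; (5) if $\{w\}\mathcal{Z}_1\{w'\}$, $X\subseteq R[w]$ and $|X|=i\ge1$, then there exists $X'\in\mathcal{P}_{<\omega}(W')$ with $X'\subseteq R'[w']$ and $X\mathcal{Z}_iX'$; (6) if $\{w\}\mathcal{Z}_1\{w'\}$, $X'\subseteq R'[w']$ and $|X'|=i\ge1$, then there exists $X\in\mathcal{P}_{<\omega}(W)$ with $X\subseteq R[w]$ and $X\mathcal{Z}_iX'$; (7) if $X\mathcal{Z}_iX'$, then (a) $\forall x\in X\,\exists x'\in X':\{x\}\mathcal{Z}_1\{x'\}$ and (b) $\forall x'\in X'\,\exists x\in X:\{x\}\mathcal{Z}_1\{x'\}$. *)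

theory Defs
  imports Main
begin

record ('w, 'p) kripke =
  worlds :: "'w set"
  acc :: "('w \<times> 'w) set"
  val :: "'p \<Rightarrow> 'w set"

text \<open>The set of proposition letters is an explicit carrier \<open>Prop\<close>, so that it may be empty;
  the values of \<open>val\<close> outside of \<open>Prop\<close> are irrelevant.\<close>

definition kripke_model :: "'p set \<Rightarrow> ('w, 'p) kripke \<Rightarrow> bool" where
  "kripke_model Prop M \<longleftrightarrow>
     acc M \<subseteq> worlds M \<times> worlds M \<and> (\<forall>p\<in>Prop. val M p \<subseteq> worlds M)"

definition satisfies :: "('w, 'p) kripke \<Rightarrow> 'w \<Rightarrow> 'p \<Rightarrow> bool" where
  "satisfies M w p \<longleftrightarrow> w \<in> val M p"

definition same_letters ::
  "'p set \<Rightarrow> ('w, 'p) kripke \<Rightarrow> ('v, 'p) kripke \<Rightarrow> 'w \<Rightarrow> 'v \<Rightarrow> bool" where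
  "same_letters Prop M M' w w' \<longleftrightarrow> (\<forall>p\<in>Prop. satisfies M w p \<longleftrightarrow> satisfies M' w' p)"

definition succs :: "('w, 'p) kripke \<Rightarrow> 'w \<Rightarrow> 'w set" where
  "succs M w = acc M `` {w}"

text \<open>Infinite sets have \<open>card\<close> equal to \<open>0\<close>, hence the separate disjunct.\<close>

definition Pow_ge :: "nat \<Rightarrow> 'a set \<Rightarrow> 'a set set" where
  "Pow_ge n X = {Y. Y \<subseteq> X \<and> (infinite Y \<or> n \<le> card Y)}"

definition upset :: "'a set \<Rightarrow> 'a set set \<Rightarrow> 'a set set" where
  "upset W \<Gamma> = {Y \<in> Pow W. \<exists>X\<in>\<Gamma>. X \<subseteq> Y}"

definition graded_bisimulation ::
  "'p set \<Rightarrow> ('w, 'p) kripke \<Rightarrow> ('v, 'p) kripke \<Rightarrow> ('w \<times> 'v) set \<Rightarrow> bool" where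
  "graded_bisimulation Prop M M' Z \<longleftrightarrow>
     Z \<noteq> {} \<and> Z \<subseteq> worlds M \<times> worlds M' \<and>
     (\<forall>w\<in>worlds M. \<forall>w'\<in>worlds M'. \<forall>n::nat.
        ((w, w') \<in> Z \<longrightarrow> same_letters Prop M M' w w') \<and>
        (\<forall>X. (w, w') \<in> Z \<and> X \<in> upset (worlds M) (Pow_ge n (succs M w)) \<longrightarrow>
           (\<exists>X'\<subseteq>worlds M'. X' \<in> upset (worlds M') (Pow_ge n (succs M' w')) \<and>
              (\<forall>x'\<in>X'. \<exists>x\<in>X. (x, x') \<in> Z))) \<and>
        (\<forall>X'. (w, w') \<in> Z \<and> X' \<in> upset (worlds M') (Pow_ge n (succs M' w')) \<longrightarrow>
           (\<exists>X\<subseteq>worlds M. X \<in> upset (worlds M) (Pow_ge n (succs M w)) \<and>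
              (\<forall>x\<in>X. \<exists>x'\<in>X'. (x, x') \<in> Z))))"

text \<open>A tuple \<open>(\<Z>\<^sub>1, \<Z>\<^sub>2, \<dots>)\<close> is a function on \<open>nat\<close> whose value at \<open>0\<close> is unconstrained
  and never used. \<open>Fpow\<close> is the set of finite subsets; for \<open>i \<ge> 1\<close>, \<open>card X = i\<close> entails that
  \<open>X\<close> is finite.\<close>

definition graded_tuple_bisimulation ::
  "'p set \<Rightarrow> ('w, 'p) kripke \<Rightarrow> ('v, 'p) kripke \<Rightarrow> (nat \<Rightarrow> ('w set \<times> 'v set) set) \<Rightarrow> bool" where
  "graded_tuple_bisimulation Prop M M' ZZ \<longleftrightarrow>
     ZZ 1 \<noteq> {} \<and>
     (\<forall>i\<ge>1. ZZ i \<subseteq> Fpow (worlds M) \<times> Fpow (worlds M')) \<and>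
     (\<forall>i\<ge>1. \<forall>X X'. (X, X') \<in> ZZ i \<longrightarrow> card X = i \<and> card X' = i) \<and>
     (\<forall>w w'. ({w}, {w'}) \<in> ZZ 1 \<longrightarrow> same_letters Prop M M' w w') \<and>
     (\<forall>w w'. \<forall>i\<ge>1. \<forall>X. ({w}, {w'}) \<in> ZZ 1 \<and> X \<subseteq> succs M w \<and> card X = i \<longrightarrow>
        (\<exists>X'\<in>Fpow (worlds M'). X' \<subseteq> succs M' w' \<and> (X, X') \<in> ZZ i)) \<and>
     (\<forall>w w'. \<forall>i\<ge>1. \<forall>X'. ({w}, {w'}) \<in> ZZ 1 \<and> X' \<subseteq> succs M' w' \<and> card X' = i \<longrightarrow>
        (\<exists>X\<in>Fpow (worlds M). X \<subseteq> succs M w \<and> (X, X') \<in> ZZ i)) \<and>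
     (\<forall>i\<ge>1. \<forall>X X'. (X, X') \<in> ZZ i \<longrightarrow>
        (\<forall>x\<in>X. \<exists>x'\<in>X'. ({x}, {x'}) \<in> ZZ 1) \<and>
        (\<forall>x'\<in>X'. \<exists>x\<in>X. ({x}, {x'}) \<in> ZZ 1))"

end

theory Submission
  imports Defs
begin

text \<open>A set lies in the up-set of the at-least-n subsets of S only if it contains n elements
  of S. For Forth with n \<ge> 1, pick exactly n successors Y of w inside X. The tuple matches Y in
  \<open>ZZ n\<close> with a set Y' of n successors of w', and by the covering clause every element
  of Y' is Z-related to one of Y, hence of X. So Y' itself is the required witness. Back is the
  mirror image; \<open>upset_Pow_ge_transfer\<close> serves both.\<close>

text \<open>Infinite sets, like finite sets of size at least n, have subsets of size n. Exact size
  matters because \<open>ZZ n\<close> relates only sets of that size.\<close>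

lemma upset_Pow_ge_obtain_card:
  assumes "X \<in> upset W (Pow_ge n S)"
  obtains Y where "Y \<subseteq> X" "Y \<subseteq> S" "card Y = n"
proof -
  from assms obtain T where T: "T \<subseteq> S" "T \<subseteq> X" "infinite T \<or> n \<le> card T"
    by (auto simp: upset_def Pow_ge_def)
  obtain Y where "Y \<subseteq> T" "card Y = n"
    using T(3) by (metis infinite_arbitrarily_large obtain_subset_with_card_n)
  with T show thesis
    using that by blast
qed

text \<open>The tuple conditions constrain only sets of size \<open>n \<ge> 1\<close>; for \<open>n = 0\<close> the empty set is a
  witness.\<close>

lemma upset_Pow_ge_transfer:
  assumes X: "X \<in> upset W (Pow_ge n S)" and S': "S' \<subseteq> W'"
    and match: "\<And>Y. n \<ge> 1 \<Longrightarrow> Y \<subseteq> S \<Longrightarrow> card Y = n \<Longrightarrow>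
      \<exists>Y'\<subseteq>S'. card Y' = n \<and> (\<forall>y'\<in>Y'. \<exists>y\<in>Y. P y y')"
  shows "\<exists>X'\<subseteq>W'. X' \<in> upset W' (Pow_ge n S') \<and> (\<forall>x'\<in>X'. \<exists>x\<in>X. P x x')"
proof -
  obtain Y where Y: "Y \<subseteq> X" "Y \<subseteq> S" "card Y = n"
    using upset_Pow_ge_obtain_card[OF X] .
  obtain Y' where Y': "Y' \<subseteq> S'" "card Y' = n" "\<forall>y'\<in>Y'. \<exists>y\<in>Y. P y y'"
  proof (cases "n = 0")
    case True
    then show thesis
      using that[of "{}"] by simp
  next
    case False
    then show thesis
      using match[OF _ Y(2,3)] that by auto
  qed
  have "Y' \<in> upset W' (Pow_ge n S')"
    using Y'(1,2) S' by (auto simp: upset_def Pow_ge_def)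
  moreover have "\<forall>x'\<in>Y'. \<exists>x\<in>X. P x x'"
    using Y(1) Y'(3) by blast
  ultimately show ?thesis
    using Y'(1) S' by (intro exI[of _ Y']) simp
qed

lemma succs_subset_worlds: "kripke_model Prop M \<Longrightarrow> succs M w \<subseteq> worlds M"
  by (auto simp: kripke_model_def succs_def)

theorem proposition7p6:
  fixes Prop :: "'p set"
    and M :: "('w, 'p) kripke" and M' :: "('v, 'p) kripke"
    and ZZ :: "nat \<Rightarrow> ('w set \<times> 'v set) set"
    and Z :: "('w \<times> 'v) set"
  assumes "kripke_model Prop M" and "kripke_model Prop M'"
    and "graded_tuple_bisimulation Prop M M' ZZ"
    and "Z = {(w, w') \<in> worlds M \<times> worlds M'. ({w}, {w'}) \<in> ZZ 1}"
  shows "graded_bisimulation Prop M M' Z"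
proof -
  note tuple = assms(3)[unfolded graded_tuple_bisimulation_def]
  note tuple2 = conjunct2[OF tuple]
  note tuple3 = conjunct2[OF tuple2]
  note tuple4 = conjunct2[OF tuple3]
  note tuple5 = conjunct2[OF tuple4]
  note tuple6 = conjunct2[OF tuple5]
  note nonempty = conjunct1[OF tuple]
    and finite_subsets = conjunct1[OF tuple2, rule_format]
    and card = conjunct1[OF tuple3, rule_format]
    and letters = conjunct1[OF tuple4, rule_format]
    and tuple_forth = conjunct1[OF tuple5, rule_format]
    and tuple_back = conjunct1[OF tuple6, rule_format]
    and cover = conjunct2[OF tuple6, rule_format]
  note succs_sub = succs_subset_worlds[OF assms(1)] succs_subset_worlds[OF assms(2)]
  \<comment> \<open>The restriction to worlds in \<open>Z\<close> loses nothing: \<open>ZZ 1\<close>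
    relates only subsets of the two sets of worlds.\<close>
  have Z_iff: "({w}, {w'}) \<in> ZZ 1 \<longleftrightarrow> (w, w') \<in> Z" for w w'
    using finite_subsets[of 1] assms(4) by (auto simp: Fpow_def)
  have "Z \<noteq> {}"
  proof -
    obtain X X' where XX': "(X, X') \<in> ZZ 1"
      using nonempty by fastforce
    then obtain w where "X = {w}"
      using card[of 1 X X'] card_1_singletonE by auto
    \<comment> \<open>Covering the single element w of X yields its partner in X'.\<close>
    then obtain w' where "({w}, {w'}) \<in> ZZ 1"
      using conjunct1[OF cover[OF _ XX']] by auto
    then show ?thesis
      unfolding Z_iff by blast
  qed
  moreover have "Z \<subseteq> worlds M \<times> worlds M'"
    using assms(4) by blast
  moreover have "\<exists>X'\<subseteq>worlds M'. X' \<in> upset (worlds M') (Pow_ge n (succs M' w')) \<and>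
      (\<forall>x'\<in>X'. \<exists>x\<in>X. (x, x') \<in> Z)"
    if wZ: "(w, w') \<in> Z" and big: "X \<in> upset (worlds M) (Pow_ge n (succs M w))" for w w' n X
  proof (rule upset_Pow_ge_transfer[OF big succs_sub(2)])
    fix Y assume Y: "n \<ge> 1" "Y \<subseteq> succs M w" "card Y = n"
    then obtain Y' where Y': "Y' \<subseteq> succs M' w'" "(Y, Y') \<in> ZZ n"
      using tuple_forth[unfolded Z_iff, OF Y(1) conjI[OF wZ conjI[OF Y(2,3)]]] by blast
    \<comment> \<open>The half of \<open>cover\<close> that quantifies over all of Y' is the one
      Forth demands.\<close>
    show "\<exists>Y'\<subseteq>succs M' w'. card Y' = n \<and> (\<forall>y'\<in>Y'. \<exists>y\<in>Y. (y, y') \<in> Z)"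
      using Y'(1) card[OF Y(1) Y'(2)] cover[OF Y(1) Y'(2), unfolded Z_iff]
      by (intro exI[of _ Y']) simp
  qed
  moreover have "\<exists>X\<subseteq>worlds M. X \<in> upset (worlds M) (Pow_ge n (succs M w)) \<and>
      (\<forall>x\<in>X. \<exists>x'\<in>X'. (x, x') \<in> Z)"
    if wZ: "(w, w') \<in> Z" and big: "X' \<in> upset (worlds M') (Pow_ge n (succs M' w'))" for w w' n X'
  \<comment> \<open>The transfer lemma now runs from \<open>M'\<close> to \<open>M\<close>, with the
    converse of \<open>Z\<close> as its relation; the other half of \<open>cover\<close>
    applies.\<close>
  proof (rule upset_Pow_ge_transfer[OF big succs_sub(1)])
    fix Y' assume Y': "n \<ge> 1" "Y' \<subseteq> succs M' w'" "card Y' = n"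
    then obtain Y where Y: "Y \<subseteq> succs M w" "(Y, Y') \<in> ZZ n"
      using tuple_back[unfolded Z_iff, OF Y'(1) conjI[OF wZ conjI[OF Y'(2,3)]]] by blast
    show "\<exists>Y\<subseteq>succs M w. card Y = n \<and> (\<forall>y\<in>Y. \<exists>y'\<in>Y'. (y, y') \<in> Z)"
      using Y(1) card[OF Y'(1) Y(2)] cover[OF Y'(1) Y(2), unfolded Z_iff]
      by (intro exI[of _ Y]) simp
  qed
  ultimately show ?thesis
    using letters[unfolded Z_iff] unfolding graded_bisimulation_def
    by (intro conjI ballI allI impI; (elim conjE)?; simp only:)
qed

end
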